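(* Let $\mu,\beta,\gamma$ be positive reals with $\gamma+\beta+\sqrt{\mu}<\frac{1}{2000}$. Let $G$ be a bipartite graph with bipartition $A\cup B$, $|A|=|B|=m$, minimum degree at least $\frac{m}{10}$ and $e(A,B)\ge(1-\beta)m^2$. Let $\mathcal{F}$ be a $\mu m$-bounded incompatibility system over $G$, and suppose $G$ has a perfect matching consisting of edges $e_1,\dots,e_m$. Then there exists a Hamilton cycle in $G$ containing the edges $e_1,\dots,e_{\gamma m}$ that is compatible with $\mathcal{F}$.
   Context: All graphs are finite and simple; $e(A,B)$ is the number of edges between $A$ and $B$. Floor signs are omitted as in the paper: $\gamma m$ is treated as an integer. An incompatibility system $\mathcal{F}$ over $G=(V,E)$ is a family $\{F_v\}_{v\in V}$ where each $F_v$ is a set of unordered pairs $\{e,e'\}$ of distinct edges with $e\cap e'=\{v\}$; edges $e,e'$ are incompatible if $\{e,e'\}\in F_v$ for some $v$, compatible otherwise. A cycle is compatible with $\mathcal{F}$ if every pair of its edges is compatible. For a positive real $\Delta$, $\mathcal{F}$ is $\Delta$-bounded if for every vertex $v$ and edge $e\ni v$, at most $\Delta$ other edges $e'\ni v$ satisfy $\{e,e'\}\in F_v$.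
   Formalization: The formal theorem assumes m ≥ 2: for m = 1 the single-edge graph meets all hypotheses (reading γm as its floor) but has no Hamilton cycle, and m = 0 gives the empty graph; γm is read as ⌊γm⌋. *)

theory Defs
  imports Complex_Main
begin

definition bipartite_graph :: "'a set \<Rightarrow> 'a set \<Rightarrow> 'a set set \<Rightarrow> bool" where
  "bipartite_graph A B E \<longleftrightarrow> finite A \<and> finite B \<and> A \<inter> B = {} \<and>
     (\<forall>e\<in>E. \<exists>a\<in>A. \<exists>b\<in>B. e = {a, b})"

definition degree :: "'a set set \<Rightarrow> 'a \<Rightarrow> nat" where
  "degree E v = card {e \<in> E. v \<in> e}"

definition e_between :: "'a set set \<Rightarrow> 'a set \<Rightarrow> 'a set \<Rightarrow> nat" where
  "e_between E A B = card {e \<in> E. \<exists>a\<in>A. \<exists>b\<in>B. e = {a, b}}"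

definition incompatibility_system :: "'a set set \<Rightarrow> ('a \<Rightarrow> 'a set set set) \<Rightarrow> bool" where
  "incompatibility_system E F \<longleftrightarrow>
     (\<forall>v. \<forall>p\<in>F v. \<exists>e e'. p = {e, e'} \<and> e \<in> E \<and> e' \<in> E \<and> e \<noteq> e' \<and> e \<inter> e' = {v})"

definition incompatible :: "('a \<Rightarrow> 'a set set set) \<Rightarrow> 'a set \<Rightarrow> 'a set \<Rightarrow> bool" where
  "incompatible F e e' \<longleftrightarrow> (\<exists>v. {e, e'} \<in> F v)"

definition bounded_incompat :: "real \<Rightarrow> 'a set set \<Rightarrow> ('a \<Rightarrow> 'a set set set) \<Rightarrow> bool" where
  "bounded_incompat \<Delta> E F \<longleftrightarrow>
     (\<forall>v. \<forall>e\<in>E. v \<in> e \<longrightarrow>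
        real (card {e' \<in> E. v \<in> e' \<and> e' \<noteq> e \<and> {e, e'} \<in> F v}) \<le> \<Delta>)"

definition cycle_edges :: "'a list \<Rightarrow> 'a set set" where
  "cycle_edges vs = {{vs ! i, vs ! (Suc i mod length vs)} | i. i < length vs}"

definition is_cycle :: "'a set set \<Rightarrow> 'a list \<Rightarrow> bool" where
  "is_cycle E vs \<longleftrightarrow> length vs \<ge> 3 \<and> distinct vs \<and> cycle_edges vs \<subseteq> E"

definition hamilton_cycle :: "'a set \<Rightarrow> 'a set set \<Rightarrow> 'a list \<Rightarrow> bool" where
  "hamilton_cycle V E vs \<longleftrightarrow> is_cycle E vs \<and> set vs = V"

definition compatible_cycle :: "('a \<Rightarrow> 'a set set set) \<Rightarrow> 'a list \<Rightarrow> bool" where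
  "compatible_cycle F vs \<longleftrightarrow>
     (\<forall>e\<in>cycle_edges vs. \<forall>e'\<in>cycle_edges vs. e \<noteq> e' \<longrightarrow> \<not> incompatible F e e')"

end

theory Submission
  imports Defs "HOL-Combinatorics.Transposition"
begin

text \<open>
  If a perfect matching M of G is fixed, every second edge of an alternating Hamilton cycle lies in M,
  so such a cycle is compatible as soon as each of its other edges is compatible with the two edges
  of M that it meets. Contracting M turns these cycles into directed Hamilton cycles of a digraph on
  the edges of M, in which incompatibilities have disappeared.

  A vertex has large degree in the digraph unless it is of low degree in G or many of its edges are
  incompatible with edges of M. The latter is excluded for all vertices simultaneously by taking M,
  among all perfect matchings that contain the prescribed edges and the given edges at vertices of
  low degree, to minimise the sum of 2 to the power c(v) over all vertices v, where c(v) counts the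
  edges of M that are incompatible with the edge joining v to one of their endpoints: averaging over
  all ways to swap the partners of two edges of M shows that otherwise some swap decreases the sum.

  In the digraph the few vertices of low degree are first strung together greedily, and a longest
  cycle through all of them spans since a missing vertex could be inserted.
\<close>

section \<open>Directed Hamilton cycles\<close>

lemma ex_connecting_vertex:
  fixes D :: "'v \<Rightarrow> 'v \<Rightarrow> bool"
  assumes "finite V" "X \<subseteq> V" "u \<in> X" "v \<in> X"
    and "8 * card {w \<in> V. w \<noteq> u \<and> \<not> D u w} \<le> card V"
    and "8 * card {w \<in> V. w \<noteq> v \<and> \<not> D w v} \<le> card V"
    and "4 * card X < 3 * card V"
  shows "\<exists>w \<in> V - X. D u w \<and> D w v"
proof (rule ccontr)
  assume "\<not> ?thesis"
  then have "V \<subseteq> X \<union> {w \<in> V. w \<noteq> u \<and> \<not> D u w} \<union> {w \<in> V. w \<noteq> v \<and> \<not> D w v}"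
    using assms by blast
  then have "card V \<le> card (X \<union> {w \<in> V. w \<noteq> u \<and> \<not> D u w} \<union> {w \<in> V. w \<noteq> v \<and> \<not> D w v})"
    using assms(1,2) by (intro card_mono) (auto intro: finite_subset)
  also have "\<dots> \<le> card X + card {w \<in> V. w \<noteq> u \<and> \<not> D u w} + card {w \<in> V. w \<noteq> v \<and> \<not> D w v}"
    by (meson add_le_mono1 card_Un_le le_trans)
  finally show False using assms by linarith
qed

lemma ex_insertion_point:
  fixes D :: "'v \<Rightarrow> 'v \<Rightarrow> bool"
  assumes "finite V" "distinct xs" "set xs \<subseteq> V" "v \<in> V - set xs"
    and "8 * card {w \<in> V. w \<noteq> v \<and> \<not> D v w} \<le> card V"
    and "8 * card {w \<in> V. w \<noteq> v \<and> \<not> D w v} \<le> card V"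
    and "card V < 4 * (length xs - 1)"
  shows "\<exists>ys zs. xs = ys @ zs \<and> ys \<noteq> [] \<and> zs \<noteq> [] \<and> D (last ys) v \<and> D v (hd zs)"
proof -
  let ?S = "{i. i < length xs - 1 \<and> \<not> D (xs ! i) v}"
  let ?T = "{i. i < length xs - 1 \<and> \<not> D v (xs ! Suc i)}"
  have "card ?S \<le> card {w \<in> V. w \<noteq> v \<and> \<not> D w v}"
    using assms by (intro card_inj_on_le[of "(!) xs"])
      (auto simp: inj_on_def nth_eq_iff_index_eq nth_mem subset_iff)
  moreover have "card ?T \<le> card {w \<in> V. w \<noteq> v \<and> \<not> D v w}"
    using assms by (intro card_inj_on_le[of "\<lambda>i. xs ! Suc i"])
      (auto simp: inj_on_def nth_eq_iff_index_eq nth_mem subset_iff)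
  ultimately have "card (?S \<union> ?T) < length xs - 1"
    using card_Un_le[of ?S ?T] assms by linarith
  then have "\<not> {..<length xs - 1} \<subseteq> ?S \<union> ?T"
    using card_mono[of "?S \<union> ?T" "{..<length xs - 1}"] by auto
  then obtain i where i: "Suc i < length xs" "D (xs ! i) v" "D v (xs ! Suc i)"
    by (auto simp: less_diff_conv)
  then have "D (last (take (Suc i) xs)) v" "D v (hd (drop (Suc i) xs))"
    by (simp_all add: take_Suc_conv_app_nth hd_drop_conv_nth)
  moreover have "xs = take (Suc i) xs @ drop (Suc i) xs" "take (Suc i) xs \<noteq> []" "drop (Suc i) xs \<noteq> []"
    using i by auto
  ultimately show ?thesis by blast
qed

lemma directed_hamilton_cycle:
  fixes D :: "'v \<Rightarrow> 'v \<Rightarrow> bool"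
  assumes fin: "finite V" and n: "card V \<ge> 2" and L: "L \<subseteq> V" "10 * card L \<le> card V"
    and out: "\<And>v. v \<in> V - L \<Longrightarrow> 8 * card {w \<in> V. w \<noteq> v \<and> \<not> D v w} \<le> card V"
    and inn: "\<And>v. v \<in> V - L \<Longrightarrow> 8 * card {w \<in> V. w \<noteq> v \<and> \<not> D w v} \<le> card V"
    and outL: "\<And>v. v \<in> L \<Longrightarrow> 5 * card L \<le> card {w \<in> V. D v w}"
    and innL: "\<And>v. v \<in> L \<Longrightarrow> 5 * card L \<le> card {w \<in> V. D w v}"
  shows "\<exists>xs. distinct xs \<and> set xs = V \<and> successively D xs \<and> D (last xs) (hd xs)"
proof -
  have finL: "finite L" using fin L finite_subset by blast
  define path where "path xs \<longleftrightarrow> xs \<noteq> [] \<and> distinct xs \<and> set xs \<subseteq> V \<and> successively D xs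
    \<and> hd xs \<in> V - L \<and> last xs \<in> V - L" for xs
  have "\<exists>xs. path xs \<and> length xs = 4 * card M + 1 \<and> set xs \<inter> L = M" if "M \<subseteq> L" for M
    using finite_subset[OF that finL] that
  proof (induction M rule: finite_induct)
    case empty
    have "card L < card V" using L n by linarith
    then have "\<not> V \<subseteq> L" using card_mono[OF finL, of V] by auto
    then obtain v where "v \<in> V - L" by blast
    then show ?case by (intro exI[of _ "[v]"]) (auto simp: path_def)
  next
    case (insert l M)
    then obtain xs where xs: "path xs" "length xs = 4 * card M + 1" "set xs \<inter> L = M" by auto
    have cM: "card M + 1 \<le> card L"
      using insert card_mono[OF finL, of "insert l M"] by simp
    define X where "X = set xs \<union> L"
    have finX: "finite X" and XV: "X \<subseteq> V" using finL xs L by (auto simp: X_def path_def)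
    have "X = set xs \<union> (L - M)" using xs by (auto simp: X_def)
    then have "card X \<le> card (set xs) + card (L - M)" using card_Un_le by metis
    then have cX: "card X + 2 \<le> 5 * card L"
      using cM card_Diff_subset[of M L] insert card_length[of xs] xs(2) by simp
    have lL: "l \<in> L" using insert by auto
    obtain p where p: "p \<in> V" "D p l" "p \<notin> X"
    proof -
      have "card X < card {w \<in> V. D w l}" using cX innL[OF lL] by linarith
      then have "\<not> {w \<in> V. D w l} \<subseteq> X" using card_mono[OF finX] by (meson not_le)
      then show ?thesis using that by auto
    qed
    obtain s where s: "s \<in> V" "D l s" "s \<notin> insert p X"
    proof -
      have "card (insert p X) < card {w \<in> V. D l w}"
        using cX outL[OF lL] p finX by simp
      then have "\<not> {w \<in> V. D l w} \<subseteq> insert p X"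
        using card_mono[of "insert p X" "{w \<in> V. D l w}"] finX by auto
      then show ?thesis using that by auto
    qed
    define Y where "Y = insert s (insert p X)"
    have cY: "card Y = card X + 2" using p s finX by (simp add: Y_def)
    have "\<exists>x \<in> V - Y. D (last xs) x \<and> D x p"
    proof (rule ex_connecting_vertex[OF fin])
      show "Y \<subseteq> V" using XV p s by (auto simp: Y_def)
      show "last xs \<in> Y" using xs by (auto simp: Y_def X_def path_def)
      show "4 * card Y < 3 * card V" using cY cX L n by linarith
      show "8 * card {w \<in> V. w \<noteq> last xs \<and> \<not> D (last xs) w} \<le> card V"
        using xs by (intro out) (auto simp: path_def)
      show "8 * card {w \<in> V. w \<noteq> p \<and> \<not> D w p} \<le> card V"
        using p by (intro inn) (auto simp: X_def)
    qed (simp add: Y_def)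
    then obtain x where x: "x \<in> V" "x \<notin> Y" "D (last xs) x" "D x p" by auto
    have "l \<notin> set xs" using xs insert by auto
    then have "path (xs @ [x, p, l, s])"
      using xs x p s lL L unfolding path_def
      by (auto simp: successively_append_iff Y_def X_def)
    moreover have "set (xs @ [x, p, l, s]) \<inter> L = insert l M"
      using xs x p s lL by (auto simp: Y_def X_def)
    ultimately show ?case using xs insert by (intro exI[of _ "xs @ [x, p, l, s]"]) auto
  qed
  from this[of L] obtain xs where xs: "path xs" "length xs = 4 * card L + 1" "L \<subseteq> set xs"
    by auto
  define cyc where "cyc xs \<longleftrightarrow> path xs \<and> L \<subseteq> set xs \<and> D (last xs) (hd xs) \<and> 2 \<le> length xs" for xs
  have close: "\<exists>x. cyc (xs @ [x])" if "path xs" "L \<subseteq> set xs" "4 * length xs < 3 * card V" for xs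
  proof -
    have "\<exists>x \<in> V - set xs. D (last xs) x \<and> D x (hd xs)"
      using that by (intro ex_connecting_vertex[OF fin] out inn)
        (auto simp: path_def distinct_card)
    then obtain x where x: "x \<in> V - set xs" "D (last xs) x" "D x (hd xs)" by auto
    then have "cyc (xs @ [x])"
      using that unfolding cyc_def path_def
      by (auto simp: successively_append_iff Suc_le_eq hd_append)
    then show ?thesis ..
  qed
  have "4 * length xs < 3 * card V"
    using xs(2) L n by (cases "card L = 0") linarith+
  then obtain x where "cyc (xs @ [x])" using close xs by blast
  moreover have bound: "length ys \<le> card V" if "cyc ys" for ys
    using that card_mono[OF fin, of "set ys"] by (simp add: cyc_def path_def distinct_card)
  then have "\<forall>ys. cyc ys \<longrightarrow> length ys < Suc (card V)" by (simp add: less_Suc_eq_le)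
  ultimately obtain ys where ys: "cyc ys" and max: "\<And>zs. cyc zs \<Longrightarrow> length zs \<le> length ys"
    using ex_has_greatest_nat[of cyc _ length] by metis
  have "set ys = V"
  proof (rule ccontr)
    assume "set ys \<noteq> V"
    then obtain v where v: "v \<in> V - set ys" using ys by (auto simp: cyc_def path_def)
    show False
    proof (cases "4 * length ys < 3 * card V")
      case True
      then obtain x where "cyc (ys @ [x])" using close ys unfolding cyc_def by blast
      then show False using max by fastforce
    next
      case False
      have vL: "v \<in> V - L" using v ys by (auto simp: cyc_def)
      have "set ys \<subset> V" using ys v by (auto simp: cyc_def path_def)
      then have "length ys < card V"
        using psubset_card_mono[OF fin] ys by (simp add: cyc_def path_def distinct_card[symmetric])
      then have "card V < 4 * (length ys - 1)"
        using False ys unfolding cyc_def by linarith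
      then obtain us zs where uz: "ys = us @ zs" "us \<noteq> []" "zs \<noteq> []"
          "D (last us) v" "D v (hd zs)"
        using ex_insertion_point[OF fin, of ys v D] v out[OF vL] inn[OF vL] ys
        unfolding cyc_def path_def by blast
      then have "cyc (us @ v # zs)"
        using ys v unfolding cyc_def path_def
        by (auto simp: successively_append_iff successively_Cons)
      then show False using max[of "us @ v # zs"] uz by simp
    qed
  qed
  then show ?thesis using ys unfolding cyc_def path_def by blast
qed

section \<open>Spread perfect matchings\<close>

lemma card_Collect_bij_betw:
  assumes "bij_betw \<pi> I J"
  shows "card {k \<in> I. P (\<pi> k)} = card {k \<in> J. P k}"
proof -
  have "\<pi> ` {k \<in> I. P (\<pi> k)} = {k \<in> J. P k}"
    using bij_betw_imp_surj_on[OF assms] by auto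
  then have "bij_betw \<pi> {k \<in> I. P (\<pi> k)} {k \<in> J. P k}"
    using bij_betw_subset[OF assms, of "{k \<in> I. P (\<pi> k)}"] by auto
  then show ?thesis by (rule bij_betw_same_card)
qed

lemma card_swap:
  assumes "finite I" "i \<in> I" "j \<in> I"
  shows "card {k \<in> I. Q k ((\<pi> \<circ> transpose i j) k)} + of_bool (Q i (\<pi> i)) + of_bool (Q j (\<pi> j)) =
    card {k \<in> I. Q k (\<pi> k)} + of_bool (Q i (\<pi> j)) + (of_bool (Q j (\<pi> i)) :: nat)"
proof (cases "i = j")
  case False
  have split: "card {k \<in> I. P k} = card {k \<in> I - {i, j}. P k} + of_bool (P i) + of_bool (P j)" for P
  proof -
    have "card {k \<in> I. P k} = (\<Sum>k\<in>I. of_bool (P k))"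
      using assms by (simp add: sum_of_bool_eq Int_def)
    also have "\<dots> = of_bool (P i) + (of_bool (P j) + (\<Sum>k\<in>I - {i} - {j}. of_bool (P k)))"
      using assms False
      by (subst sum.remove[of I i], simp, simp, subst sum.remove[of "I - {i}" j]) simp_all
    also have "I - {i} - {j} = I - {i, j}" by auto
    also have "(\<Sum>k\<in>I - {i, j}. of_bool (P k)) = card {k \<in> I - {i, j}. P k}"
      using assms by (simp add: sum_of_bool_eq Int_def)
    finally show ?thesis by simp
  qed
  have "{k \<in> I - {i, j}. Q k ((\<pi> \<circ> transpose i j) k)} = {k \<in> I - {i, j}. Q k (\<pi> k)}"
    by (auto simp: transpose_def)
  then show ?thesis
    using split[of "\<lambda>k. Q k ((\<pi> \<circ> transpose i j) k)"] split[of "\<lambda>k. Q k (\<pi> k)"] by simp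
qed simp

lemma two_power_swap_le:
  fixes c c' :: nat and a b p q :: bool
  assumes "c' + of_bool a + of_bool b = c + of_bool p + of_bool q"
  shows "(2::real) ^ c' - 2 ^ c \<le>
    2 ^ c * (3/2 * (of_bool p + of_bool q) - 3/8 * (of_bool a + of_bool b))"
  using assms by (cases a; cases b; cases p; cases q) (auto simp: algebra_simps)

lemma sum_card_fibres:
  assumes "finite I" "bij_betw \<pi> I I"
  shows "(\<Sum>(i, j) \<in> I \<times> I. of_bool (P i (\<pi> j)) :: real) = card {(i, j). i \<in> I \<and> j \<in> I \<and> P i j}"
proof -
  have "(\<Sum>(i, j) \<in> I \<times> I. of_bool (P i (\<pi> j)) :: real) = (\<Sum>i\<in>I. \<Sum>j\<in>I. of_bool (P i (\<pi> j)))"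
    by (simp add: sum.cartesian_product)
  also have "\<dots> = (\<Sum>i\<in>I. \<Sum>j\<in>I. of_bool (P i j))"
    by (intro sum.cong refl sum.reindex_bij_betw[OF assms(2)])
  also have "\<dots> = (\<Sum>p \<in> I \<times> I. of_bool (P (fst p) (snd p)))"
    by (simp add: sum.cartesian_product case_prod_unfold)
  also have "\<dots> = card {p \<in> I \<times> I. P (fst p) (snd p)}"
    using assms by (simp add: sum_of_bool_eq Int_def)
  also have "{p \<in> I \<times> I. P (fst p) (snd p)} = {(i, j). i \<in> I \<and> j \<in> I \<and> P i j}" by auto
  finally show ?thesis .
qed

lemma ex_spread_matching:
  fixes I :: "'i set" and Q :: "'x \<Rightarrow> 'i \<Rightarrow> 'i \<Rightarrow> bool" and adj :: "'i \<Rightarrow> 'i \<Rightarrow> bool"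
    and \<nu> d :: real and N r :: nat
  assumes fin: "finite I" "finite X" and KI: "K \<subseteq> I"
    and diag: "\<And>i. i \<in> I \<Longrightarrow> adj i i"
    and Q: "\<And>x. x \<in> X \<Longrightarrow> card {(i, j). i \<in> I \<and> j \<in> I \<and> Q x i j} \<le> \<nu>"
    and deg: "\<And>i j. i \<in> I - K \<Longrightarrow> j \<in> I - K \<Longrightarrow>
      real (card {k \<in> I - K. \<not> adj i k}) + real (card {k \<in> I - K. \<not> adj k j}) + d \<le> card (I - K)"
    and d: "d > 0" and N: "4 * \<nu> \<le> d * (real N - card K)"
    and r: "4 * card X * \<nu> < d * r * 2 ^ r"
  shows "\<exists>\<pi>. bij_betw \<pi> I I \<and> (\<forall>i\<in>K. \<pi> i = i) \<and> (\<forall>i\<in>I. adj i (\<pi> i)) \<and>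
    (\<forall>x\<in>X. card {i \<in> I. Q x i (\<pi> i)} < N + r)"
proof -
  define ok where "ok \<pi> \<longleftrightarrow> bij_betw \<pi> I I \<and> (\<forall>i\<in>K. \<pi> i = i) \<and> (\<forall>i\<in>I. adj i (\<pi> i))" for \<pi>
  define c where "c \<pi> x = card {i \<in> I. Q x i (\<pi> i)}" for \<pi> x
  define \<Phi> :: "('i \<Rightarrow> 'i) \<Rightarrow> nat" where "\<Phi> \<pi> = (\<Sum>x\<in>X. 2 ^ c \<pi> x)" for \<pi>
  have "ok id" using diag by (auto simp: ok_def)
  then obtain \<pi> where \<pi>: "ok \<pi>" and min: "\<And>\<sigma>. ok \<sigma> \<Longrightarrow> \<Phi> \<pi> \<le> \<Phi> \<sigma>"
    using ex_has_least_nat[of ok id \<Phi>] by auto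
  have bij: "bij_betw \<pi> I I" and fixK: "\<And>i. i \<in> K \<Longrightarrow> \<pi> i = i"
    and ad: "\<And>i. i \<in> I \<Longrightarrow> adj i (\<pi> i)"
    using \<pi> by (auto simp: ok_def)
  have inj: "inj_on \<pi> I" using bij bij_betw_def by blast
  have \<pi>K: "\<pi> i \<in> I - K" if "i \<in> I - K" for i
    using that fixK[of "\<pi> i"] inj_onD[OF inj, of "\<pi> i" i] bij_betwE[OF bij] by auto
  define T where "T = {(i, j). i \<in> I - K \<and> j \<in> I - K \<and> adj i (\<pi> j) \<and> adj j (\<pi> i)}"
  have TI: "T \<subseteq> I \<times> I" by (auto simp: T_def)
  have finT: "finite T" using TI fin finite_subset by blast
  have ok_swap: "ok (\<pi> \<circ> transpose i j)" if "(i, j) \<in> T" for i j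
  proof -
    have ij: "i \<in> I - K" "j \<in> I - K" "adj i (\<pi> j)" "adj j (\<pi> i)" using that by (auto simp: T_def)
    have "bij_betw (transpose i j) I I" using ij by (intro bij_betw_byWitness[of _ "transpose i j"])
        (auto simp: transpose_def)
    then have "bij_betw (\<pi> \<circ> transpose i j) I I" using bij bij_betw_trans by blast
    moreover have "(\<pi> \<circ> transpose i j) k = k" if "k \<in> K" for k
      using that ij fixK by (auto simp: transpose_def)
    moreover have "adj k ((\<pi> \<circ> transpose i j) k)" if "k \<in> I" for k
      using that ij ad by (auto simp: transpose_def)
    ultimately show ?thesis by (simp add: ok_def)
  qed
  have Tdeg: "d \<le> card {j. (i, j) \<in> T}" if i: "i \<in> I - K" for i
  proof -
    have \<pi>bij: "bij_betw \<pi> (I - K) (I - K)"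
    proof -
      have "inj_on \<pi> (I - K)" using inj inj_on_subset by blast
      moreover have "\<pi> ` (I - K) \<subseteq> I - K" using \<pi>K by auto
      ultimately show ?thesis
        using fin endo_inj_surj[of "I - K" \<pi>] by (auto simp: bij_betw_def)
    qed
    have c1: "card {k \<in> I - K. \<not> adj i (\<pi> k)} = card {k \<in> I - K. \<not> adj i k}"
      by (rule card_Collect_bij_betw[OF \<pi>bij])
    have "I - K \<subseteq> {j. (i, j) \<in> T} \<union> {k \<in> I - K. \<not> adj i (\<pi> k)} \<union> {k \<in> I - K. \<not> adj k (\<pi> i)}"
      using i by (auto simp: T_def)
    then have "card (I - K) \<le> card ({j. (i, j) \<in> T} \<union> {k \<in> I - K. \<not> adj i (\<pi> k)} \<union> {k \<in> I - K. \<not> adj k (\<pi> i)})"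
      using fin by (intro card_mono) (auto simp: T_def)
    also have "\<dots> \<le> card {j. (i, j) \<in> T} + card {k \<in> I - K. \<not> adj i (\<pi> k)} + card {k \<in> I - K. \<not> adj k (\<pi> i)}"
      by (meson add_le_mono1 card_Un_le le_trans)
    finally show ?thesis using deg[OF i \<pi>K[OF i]] c1 by simp
  qed
  define h where "h x = card {i \<in> I - K. Q x i (\<pi> i)}" for x
  have c_le: "c \<pi> x \<le> h x + card K" for x
  proof -
    have "c \<pi> x \<le> card ({i \<in> I - K. Q x i (\<pi> i)} \<union> K)"
      unfolding c_def using fin finite_subset[OF KI fin(1)] by (intro card_mono) auto
    also have "\<dots> \<le> h x + card K" unfolding h_def by (rule card_Un_le)
    finally show ?thesis .
  qed
  have term_le: "(\<Sum>(i, j)\<in>T. (2::real) ^ c (\<pi> \<circ> transpose i j) x - 2 ^ c \<pi> x) \<le>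
      2 ^ c \<pi> x * (3 * \<nu> - 3/4 * (d * h x))" if x: "x \<in> X" for x
  proof -
    define inc dec where "inc = (\<lambda>(i, j). of_bool (Q x i (\<pi> j)) + (of_bool (Q x j (\<pi> i)) :: real))"
      and "dec = (\<lambda>(i, j). of_bool (Q x i (\<pi> i)) + (of_bool (Q x j (\<pi> j)) :: real))"
    have Tsym: "(\<Sum>(i, j)\<in>T. g j i) = (\<Sum>(i, j)\<in>T. (g i j :: real))" for g
      by (rule sum.reindex_bij_witness[of _ prod.swap prod.swap]) (auto simp: T_def)
    have "(\<Sum>p\<in>T. inc p) = 2 * (\<Sum>(i, j)\<in>T. of_bool (Q x i (\<pi> j)))"
      using Tsym[of "\<lambda>i j. of_bool (Q x i (\<pi> j))"]
      by (simp add: inc_def case_prod_unfold sum.distrib)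
    also have "(\<Sum>(i, j)\<in>T. of_bool (Q x i (\<pi> j)) :: real) \<le> (\<Sum>(i, j) \<in> I \<times> I. of_bool (Q x i (\<pi> j)))"
      using fin TI by (intro sum_mono2) auto
    also have "\<dots> \<le> \<nu>" using sum_card_fibres[OF fin(1) bij] Q[OF x] by simp
    finally have inc: "(\<Sum>p\<in>T. inc p) \<le> 2 * \<nu>" by simp
    have "d * h x = (\<Sum>i \<in> I - K. of_bool (Q x i (\<pi> i)) * d)"
      using fin by (simp add: h_def sum_of_bool_eq Int_def flip: sum_distrib_right)
    also have "\<dots> \<le> (\<Sum>i \<in> I - K. of_bool (Q x i (\<pi> i)) * real (card {j. (i, j) \<in> T}))"
      using Tdeg by (intro sum_mono mult_left_mono) auto
    also have "\<dots> = (\<Sum>i \<in> I - K. \<Sum>j \<in> {j. (i, j) \<in> T}. of_bool (Q x i (\<pi> i)))"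
      by (simp add: mult.commute)
    also have "\<dots> = (\<Sum>(i, j) \<in> (SIGMA i:I - K. {j. (i, j) \<in> T}). of_bool (Q x i (\<pi> i)))"
    proof (rule sum.Sigma)
      show "\<forall>i\<in>I - K. finite {j. (i, j) \<in> T}"
        using fin by (auto simp: T_def)
    qed (use fin in auto)
    also have "(SIGMA i:I - K. {j. (i, j) \<in> T}) = T" by (auto simp: T_def)
    finally have "2 * (d * h x) \<le> (\<Sum>p\<in>T. dec p)"
      using Tsym[of "\<lambda>i j. of_bool (Q x i (\<pi> i))"]
      by (simp add: dec_def case_prod_unfold sum.distrib)
    note dec = this
    have "(\<Sum>(i, j)\<in>T. (2::real) ^ c (\<pi> \<circ> transpose i j) x - 2 ^ c \<pi> x) \<le>
        (\<Sum>p\<in>T. 2 ^ c \<pi> x * (3/2 * inc p - 3/8 * dec p))"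
    proof (rule sum_mono, clarify)
      fix i j assume "(i, j) \<in> T"
      then have "i \<in> I" "j \<in> I" using TI by auto
      then show "(2::real) ^ c (\<pi> \<circ> transpose i j) x - 2 ^ c \<pi> x \<le>
          2 ^ c \<pi> x * (3/2 * inc (i, j) - 3/8 * dec (i, j))"
        unfolding inc_def dec_def prod.case c_def
        by (intro two_power_swap_le card_swap fin)
    qed
    also have "\<dots> = 2 ^ c \<pi> x * (3/2 * (\<Sum>p\<in>T. inc p) - 3/8 * (\<Sum>p\<in>T. dec p))"
      by (simp add: sum_distrib_left sum_subtractf right_diff_distrib)
    also have "\<dots> \<le> 2 ^ c \<pi> x * (3 * \<nu> - 3/4 * (d * h x))"
      using inc dec by (intro mult_left_mono) auto
    finally show ?thesis .
  qed
  have "0 \<le> (\<Sum>(i, j)\<in>T. real (\<Phi> (\<pi> \<circ> transpose i j)) - real (\<Phi> \<pi>))"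
    using min ok_swap by (intro sum_nonneg) auto
  also have "\<dots> = (\<Sum>(i, j)\<in>T. \<Sum>x\<in>X. 2 ^ c (\<pi> \<circ> transpose i j) x - 2 ^ c \<pi> x)"
    by (simp add: \<Phi>_def sum_subtractf)
  also have "\<dots> = (\<Sum>x\<in>X. \<Sum>(i, j)\<in>T. 2 ^ c (\<pi> \<circ> transpose i j) x - 2 ^ c \<pi> x)"
    unfolding case_prod_unfold by (rule sum.swap)
  also have "\<dots> \<le> (\<Sum>x\<in>X. 2 ^ c \<pi> x * (3 * \<nu> - 3/4 * (d * h x)))"
    using term_le by (rule sum_mono)
  finally have tot: "0 \<le> (\<Sum>x\<in>X. 2 ^ c \<pi> x * (3 * \<nu> - 3/4 * (d * h x)))" .
  have "c \<pi> y < N + r" if y: "y \<in> X" for y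
  proof (rule ccontr)
    assume "\<not> c \<pi> y < N + r"
    then have cy: "N + r \<le> c \<pi> y" by simp
    have \<nu>0: "0 \<le> \<nu>" using Q[OF y] by (meson of_nat_0_le_iff order_trans)
    have small: "2 ^ c \<pi> x * (3 * \<nu> - 3/4 * (d * h x)) \<le> 2 ^ N * (3 * \<nu>)" for x
    proof (cases "4 * \<nu> \<le> d * h x")
      case True
      then have "2 ^ c \<pi> x * (3 * \<nu> - 3/4 * (d * h x)) \<le> 0"
        by (intro mult_nonneg_nonpos) auto
      also have "\<dots> \<le> 2 ^ N * (3 * \<nu>)" using \<nu>0 by simp
      finally show ?thesis .
    next
      case False
      then have "d * h x < d * (real N - card K)" using N by linarith
      then have "h x + card K < N" using d by simp
      then have "c \<pi> x \<le> N" using c_le[of x] by simp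
      have "3 * \<nu> - 3/4 * (d * h x) \<le> 3 * \<nu>" using d by simp
      then have "2 ^ c \<pi> x * (3 * \<nu> - 3/4 * (d * h x)) \<le> 2 ^ c \<pi> x * (3 * \<nu>)"
        by (intro mult_left_mono) auto
      moreover have "2 ^ c \<pi> x * (3 * \<nu>) \<le> 2 ^ N * (3 * \<nu>)"
        using \<nu>0 \<open>c \<pi> x \<le> N\<close> by (intro mult_right_mono power_increasing) auto
      ultimately show ?thesis by linarith
    qed
    have hy: "real N + r - card K \<le> h y" using cy c_le[of y] by linarith
    have "d * (real N - card K) + d * r \<le> d * h y"
      using mult_left_mono[OF hy, of d] d by (simp add: algebra_simps)
    then have "3 * \<nu> - 3/4 * (d * h y) \<le> - (3/4 * (d * r))" using N by linarith
    then have "2 ^ c \<pi> y * (3 * \<nu> - 3/4 * (d * h y)) \<le> 2 ^ c \<pi> y * - (3/4 * (d * r))"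
      by (intro mult_left_mono) auto
    also have "\<dots> \<le> 2 ^ (N + r) * - (3/4 * (d * r))"
      using cy d by (intro mult_right_mono_neg power_increasing) auto
    finally have big: "2 ^ c \<pi> y * (3 * \<nu> - 3/4 * (d * h y)) \<le> 2 ^ (N + r) * - (3/4 * (d * r))" .
    have "(\<Sum>x\<in>X - {y}. 2 ^ c \<pi> x * (3 * \<nu> - 3/4 * (d * h x))) \<le> card (X - {y}) * (2 ^ N * (3 * \<nu>))"
      using small by (intro sum_bounded_above) auto
    also have "\<dots> \<le> card X * (2 ^ N * (3 * \<nu>))"
      using \<nu>0 fin by (intro mult_right_mono of_nat_mono card_mono) auto
    finally have "0 \<le> 2 ^ (N + r) * - (3/4 * (d * r)) + card X * (2 ^ N * (3 * \<nu>))"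
      using tot big sum.remove[OF fin(2) y, of "\<lambda>x. 2 ^ c \<pi> x * (3 * \<nu> - 3/4 * (d * h x))"]
      by linarith
    also have "\<dots> = 3/4 * 2 ^ N * (4 * card X * \<nu> - d * r * 2 ^ r)"
      by (simp add: power_add algebra_simps)
    also have "\<dots> < 0" using r by (intro mult_pos_neg) auto
    finally show False by simp
  qed
  then show ?thesis using \<pi> unfolding ok_def c_def by blast
qed

section \<open>Incompatible edges and alternating cycles\<close>

lemma incompatible_commute: "incompatible F e e' \<longleftrightarrow> incompatible F e' e"
  by (simp add: incompatible_def insert_commute)

lemma incompatibleE:
  assumes "incompatibility_system E F" "incompatible F e e'"
  obtains v where "{e, e'} \<in> F v" "e \<in> E" "e' \<in> E" "e \<noteq> e'" "e \<inter> e' = {v}"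
proof -
  obtain v where v: "{e, e'} \<in> F v" using assms(2) by (auto simp: incompatible_def)
  then obtain a b where "{e, e'} = {a, b}" "a \<in> E" "b \<in> E" "a \<noteq> b" "a \<inter> b = {v}"
    using assms(1) unfolding incompatibility_system_def by meson
  then show ?thesis using that[OF v] by (auto simp: doubleton_eq_iff Int_commute)
qed

lemma card_incompatible_le:
  fixes \<Delta> :: real
  assumes "incompatibility_system E F" "bounded_incompat \<Delta> E F" "\<Delta> \<ge> 0" "finite E"
    and "inj_on f I" "v \<notin> f ` I"
  shows "card {j \<in> I. incompatible F {v, f k} {v, f j}} \<le> \<Delta>"
proof (cases "{v, f k} \<in> E")
  case True
  let ?C = "{e' \<in> E. v \<in> e' \<and> e' \<noteq> {v, f k} \<and> {{v, f k}, e'} \<in> F v}"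
  have "card {j \<in> I. incompatible F {v, f k} {v, f j}} \<le> card ?C"
  proof (rule card_inj_on_le)
    show "inj_on (\<lambda>j. {v, f j}) {j \<in> I. incompatible F {v, f k} {v, f j}}"
      using assms(5) by (auto simp: inj_on_def doubleton_eq_iff)
    show "(\<lambda>j. {v, f j}) ` {j \<in> I. incompatible F {v, f k} {v, f j}} \<subseteq> ?C"
    proof safe
      fix j assume "incompatible F {v, f k} {v, f j}"
      with assms(1) obtain w where w: "{{v, f k}, {v, f j}} \<in> F w" "{v, f j} \<in> E"
          "{v, f k} \<noteq> {v, f j}" "{v, f k} \<inter> {v, f j} = {w}"
        by (rule incompatibleE)
      moreover from w(4) have "v = w" by blast
      ultimately show "{v, f j} \<in> E" "{{v, f k}, {v, f j}} \<in> F v"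
        "{v, f j} = {v, f k} \<Longrightarrow> False" by auto
    qed
  qed (use assms in auto)
  also have "real \<dots> \<le> \<Delta>" using assms(2) True unfolding bounded_incompat_def by blast
  finally show ?thesis by simp
next
  case False
  then have "{j \<in> I. incompatible F {v, f k} {v, f j}} = {}"
    using assms(1) by (auto elim: incompatibleE)
  then show ?thesis using assms(3) by (metis card.empty of_nat_0)
qed

lemma nth_concat_pairs:
  "t < length xs \<Longrightarrow> concat (map (\<lambda>i. [f i, g i]) xs) ! (2 * t) = f (xs ! t) \<and>
    concat (map (\<lambda>i. [f i, g i]) xs) ! Suc (2 * t) = g (xs ! t)"
proof (induction xs arbitrary: t)
  case (Cons x xs)
  then show ?case by (cases t) auto
qed simp

lemma length_concat_pairs: "length (concat (map (\<lambda>i. [f i, g i]) xs)) = 2 * length xs"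
  by (induction xs) auto

lemma cycle_edges_concat_pairs:
  "cycle_edges (concat (map (\<lambda>i. [f i, g i]) xs)) =
    (\<lambda>i. {f i, g i}) ` set xs \<union> {{g (xs ! t), f (xs ! (Suc t mod length xs))} | t. t < length xs}"
  (is "cycle_edges ?vs = ?M \<union> ?D")
proof -
  let ?n = "length xs"
  have even: "{?vs ! (2 * t), ?vs ! (Suc (2 * t) mod (2 * ?n))} = {f (xs ! t), g (xs ! t)}"
    if "t < ?n" for t
    using that nth_concat_pairs[OF that, of f g] by simp
  have odd: "{?vs ! Suc (2 * t), ?vs ! (Suc (Suc (2 * t)) mod (2 * ?n))} =
      {g (xs ! t), f (xs ! (Suc t mod ?n))}" if "t < ?n" for t
  proof -
    have "Suc (Suc (2 * t)) mod (2 * ?n) = 2 * (Suc t mod ?n)"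
      using mult_mod_right[of 2 "Suc t" ?n] by simp
    moreover have "Suc t mod ?n < ?n" using that by (intro mod_less_divisor) linarith
    ultimately show ?thesis
      using nth_concat_pairs[OF that, of f g] nth_concat_pairs[of "Suc t mod ?n" xs f g] by simp
  qed
  show ?thesis
  proof
    show "cycle_edges ?vs \<subseteq> ?M \<union> ?D"
    proof
      fix e assume "e \<in> cycle_edges ?vs"
      then obtain i where i: "i < 2 * ?n" "e = {?vs ! i, ?vs ! (Suc i mod (2 * ?n))}"
        unfolding cycle_edges_def length_concat_pairs by auto
      show "e \<in> ?M \<union> ?D"
      proof (cases "even i")
        case True
        then obtain t where "i = 2 * t" by blast
        then have "t < ?n" "e = {f (xs ! t), g (xs ! t)}" using i even[of t] by simp_all
        then show ?thesis by (metis (mono_tags, lifting) UnI1 imageI nth_mem)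
      next
        case False
        then obtain t where "i = 2 * t + 1" by (rule oddE)
        then have "t < ?n" "e = {g (xs ! t), f (xs ! (Suc t mod ?n))}"
          using i odd[of t] by simp_all
        then show ?thesis by blast
      qed
    qed
    show "?M \<union> ?D \<subseteq> cycle_edges ?vs"
    proof
      fix e assume "e \<in> ?M \<union> ?D"
      then consider t where "t < ?n" "e = {f (xs ! t), g (xs ! t)}"
        | t where "t < ?n" "e = {g (xs ! t), f (xs ! (Suc t mod ?n))}"
        by (auto simp: in_set_conv_nth)
      then show "e \<in> cycle_edges ?vs"
      proof cases
        case (1 t)
        then show ?thesis unfolding cycle_edges_def length_concat_pairs
          using even[of t] by (intro CollectI exI[of _ "2 * t"]) simp
      next
        case (2 t)
        then show ?thesis unfolding cycle_edges_def length_concat_pairs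
          using odd[of t] by (intro CollectI exI[of _ "Suc (2 * t)"]) simp
      qed
    qed
  qed
qed

lemma distinct_concat_pairs:
  assumes "distinct xs" "inj_on f (set xs)" "inj_on g (set xs)" "f ` set xs \<inter> g ` set xs = {}"
  shows "distinct (concat (map (\<lambda>i. [f i, g i]) xs))"
  using assms by (induction xs) (auto simp: inj_on_def)

lemma cyclic_successively_nth:
  assumes "successively D xs" "D (last xs) (hd xs)" "t < length xs"
  shows "D (xs ! t) (xs ! (Suc t mod length xs))"
proof (cases "Suc t < length xs")
  case True
  then show ?thesis using assms(1) by (simp add: successively_conv_nth)
next
  case False
  then have "Suc t = length xs" using assms by simp
  then have "xs ! t = last xs" "xs ! (Suc t mod length xs) = hd xs"
    using assms(3) last_conv_nth[of xs] hd_conv_nth[of xs]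
    by (auto dest: sym simp flip: length_greater_0_conv)
  then show ?thesis using assms(2) by simp
qed

lemma compatible_hamilton_cycleI:
  assumes f: "bij_betw f I A" and g: "bij_betw g I B" and AB: "A \<inter> B = {}"
    and sys: "incompatibility_system E F"
    and xs: "distinct xs" "set xs = I" "length xs \<ge> 2" "successively D xs" "D (last xs) (hd xs)"
    and M: "\<And>i. i \<in> I \<Longrightarrow> {f i, g i} \<in> E"
    and D: "\<And>i j. D i j \<Longrightarrow> {g i, f j} \<in> E \<and>
      \<not> incompatible F {g i, f j} {f i, g i} \<and> \<not> incompatible F {g i, f j} {f j, g j}"
  shows "\<exists>vs. hamilton_cycle (A \<union> B) E vs \<and> compatible_cycle F vs \<and> (\<forall>i\<in>I. {f i, g i} \<in> cycle_edges vs)"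
proof -
  let ?n = "length xs"
  define vs where "vs = concat (map (\<lambda>i. [f i, g i]) xs)"
  define s where "s t = xs ! (Suc t mod ?n)" for t
  have ce: "cycle_edges vs = (\<lambda>i. {f i, g i}) ` I \<union> {{g (xs ! t), f (s t)} | t. t < ?n}"
    unfolding vs_def cycle_edges_concat_pairs xs(2) s_def ..
  have Ds: "D (xs ! t) (s t)" if "t < ?n" for t
    unfolding s_def by (rule cyclic_successively_nth[OF xs(4,5) that])
  have fA: "f ` I = A" "inj_on f I" and gB: "g ` I = B" "inj_on g I"
    using f g by (auto simp: bij_betw_def)
  have mod_lt: "Suc t mod ?n < ?n" if "t < ?n" for t
    using that by (intro mod_less_divisor) linarith
  have sI: "s t \<in> I" if "t < ?n" for t
    unfolding s_def using nth_mem[OF mod_lt[OF that]] xs(2) by simp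
  have xI: "xs ! t \<in> I" if "t < ?n" for t using that xs by auto
  have fg: "f i \<noteq> g j" if "i \<in> I" "j \<in> I" for i j using that AB fA gB by auto
  have feq: "f i = f j \<longleftrightarrow> i = j" if "i \<in> I" "j \<in> I" for i j
    using that fA inj_onD by metis
  have geq: "g i = g j \<longleftrightarrow> i = j" if "i \<in> I" "j \<in> I" for i j
    using that gB inj_onD by metis
  have s_eq: "s t = s t' \<longleftrightarrow> t = t'" if "t < ?n" "t' < ?n" for t t'
  proof -
    have "Suc t mod ?n = Suc t' mod ?n \<longleftrightarrow> t = t'"
      using that by (cases "Suc t = ?n"; cases "Suc t' = ?n") auto
    then show ?thesis
      unfolding s_def using xs(1) that by (simp add: nth_eq_iff_index_eq mod_lt)
  qed
  have cross: "\<not> incompatible F {f i, g i} {g (xs ! t), f (s t)}" if "i \<in> I" "t < ?n" for i t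
  proof
    assume inc: "incompatible F {f i, g i} {g (xs ! t), f (s t)}"
    with sys obtain v where "{f i, g i} \<inter> {g (xs ! t), f (s t)} = {v}"
      by (rule incompatibleE)
    then have "v \<in> {f i, g i}" "v \<in> {g (xs ! t), f (s t)}" by blast+
    then have "g i = g (xs ! t) \<or> f i = f (s t)"
      using fg[OF that(1) xI[OF that(2)]] fg[OF sI[OF that(2)] that(1)] by auto
    then have "i = xs ! t \<or> i = s t"
      using feq[OF that(1) sI[OF that(2)]] geq[OF that(1) xI[OF that(2)]] by blast
    moreover have "incompatible F {g (xs ! t), f (s t)} {f i, g i}"
      using inc by (simp only: incompatible_commute)
    ultimately show False using D[OF Ds[OF that(2)]] by blast
  qed
  have "compatible_cycle F vs" unfolding compatible_cycle_def
  proof (intro ballI impI notI)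
    fix e e' assume e: "e \<in> cycle_edges vs" "e' \<in> cycle_edges vs" "e \<noteq> e'" "incompatible F e e'"
    obtain v where "e \<inter> e' = {v}" using incompatibleE[OF sys e(4)] by metis
    then have v: "v \<in> e" "v \<in> e'" by blast+
    consider i j where "i \<in> I" "j \<in> I" "e = {f i, g i}" "e' = {f j, g j}"
      | i t where "i \<in> I" "t < ?n" "e = {f i, g i}" "e' = {g (xs ! t), f (s t)}"
      | i t where "i \<in> I" "t < ?n" "e' = {f i, g i}" "e = {g (xs ! t), f (s t)}"
      | t t' where "t < ?n" "t' < ?n" "e = {g (xs ! t), f (s t)}" "e' = {g (xs ! t'), f (s t')}"
      using e(1,2) unfolding ce by blast
    then show False
    proof cases
      case 1
      then show False using v e(3) fg[of i j] fg[of j i] feq[of i j] geq[of i j] by auto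
    next
      case 2
      then show False using cross e(4) by blast
    next
      case 3
      then show False using cross e(4) unfolding incompatible_commute[of F e] by blast
    next
      case (4 t t')
      then have "t \<noteq> t'" using e(3) by auto
      then have "s t \<noteq> s t'" "xs ! t \<noteq> xs ! t'"
        using 4 s_eq xs(1) by (auto simp: nth_eq_iff_index_eq)
      then have "f (s t) \<noteq> f (s t')" "g (xs ! t) \<noteq> g (xs ! t')"
        using 4 feq[OF sI sI] geq[OF xI xI] by auto
      moreover have "f (s t) \<noteq> g (xs ! t')" "f (s t') \<noteq> g (xs ! t)"
        using 4 fg[OF sI xI] by auto
      ultimately show False using v 4 by auto
    qed
  qed
  moreover have "hamilton_cycle (A \<union> B) E vs"
  proof -
    have "distinct vs" unfolding vs_def
      using xs fA gB AB by (intro distinct_concat_pairs) auto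
    moreover have "length vs \<ge> 3" using xs(3) by (simp add: vs_def length_concat_pairs)
    moreover have "set vs = A \<union> B" using xs fA gB by (auto simp: vs_def)
    moreover have "cycle_edges vs \<subseteq> E" unfolding ce using M D Ds by auto
    ultimately show ?thesis by (simp add: hamilton_cycle_def is_cycle_def)
  qed
  ultimately show ?thesis unfolding ce by (intro exI[of _ vs]) (auto simp: ce)
qed

section \<open>Dense bipartite graphs with a perfect matching\<close>

lemma card_rows_mult_le:
  fixes P :: "'i \<Rightarrow> 'j \<Rightarrow> bool" and c :: real
  assumes "finite I" "finite J"
  shows "card {i \<in> I. c < card {j \<in> J. P i j}} * c \<le> card {(i, j). i \<in> I \<and> j \<in> J \<and> P i j}"
proof -
  let ?L = "{i \<in> I. c < card {j \<in> J. P i j}}"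
  have "card ?L * c = (\<Sum>i\<in>?L. c)" by simp
  also have "\<dots> \<le> (\<Sum>i\<in>?L. real (card {j \<in> J. P i j}))" by (intro sum_mono) auto
  also have "\<dots> \<le> (\<Sum>i\<in>I. real (card {j \<in> J. P i j}))"
    using assms by (intro sum_mono2) auto
  also have "\<dots> = card (SIGMA i:I. {j \<in> J. P i j})" using assms by simp
  also have "(SIGMA i:I. {j \<in> J. P i j}) = {(i, j). i \<in> I \<and> j \<in> J \<and> P i j}" by auto
  finally show ?thesis .
qed

lemma card_pairs_le:
  fixes c :: real
  assumes "finite I" "finite J" "\<And>i. i \<in> I \<Longrightarrow> card {j \<in> J. P i j} \<le> c"
  shows "card {(i, j). i \<in> I \<and> j \<in> J \<and> P i j} \<le> card I * c"
proof -
  have "{(i, j). i \<in> I \<and> j \<in> J \<and> P i j} = (SIGMA i:I. {j \<in> J. P i j})" by auto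
  then have "real (card {(i, j). i \<in> I \<and> j \<in> J \<and> P i j}) = (\<Sum>i\<in>I. real (card {j \<in> J. P i j}))"
    using assms by simp
  also have "\<dots> \<le> card I * c" using assms(3) by (rule sum_bounded_above)
  finally show ?thesis .
qed

lemma card_pairs_swap: "card {(i, j). i \<in> I \<and> j \<in> J \<and> P i j} = card {(j, i). j \<in> J \<and> i \<in> I \<and> P i j}"
  by (rule bij_betw_same_card[of prod.swap]) (rule bij_betw_byWitness[of _ prod.swap], auto)

text \<open>The index \<open>i\<close> stands for both ends of the \<open>i\<close>-th edge of the given perfect matching. Rows and columns
  of \<open>adj\<close> are the two sides of the graph, \<open>R i\<close> and \<open>S j\<close> are the incompatibilities at the \<open>i\<close>-th row
  vertex and at the \<open>j\<close>-th column vertex, and \<open>J\<close> is the set of prescribed edges.\<close>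

locale dense_index_system =
  fixes I :: "'i set" and m :: nat and adj :: "'i \<Rightarrow> 'i \<Rightarrow> bool"
    and R S :: "'i \<Rightarrow> 'i \<Rightarrow> 'i \<Rightarrow> bool" and J :: "'i set" and \<mu> \<beta> \<gamma> :: real
  assumes fin: "finite I" and cardI: "card I = m" and m: "m \<ge> 2"
    and pos: "\<mu> > 0" "\<beta> > 0" and small: "\<gamma> + \<beta> + sqrt \<mu> < 1 / 2000"
    and J: "J \<subseteq> I" "card J \<le> \<gamma> * m"
    and diag: "\<And>i. i \<in> I \<Longrightarrow> adj i i"
    and row_degree: "\<And>i. i \<in> I \<Longrightarrow> real m / 10 \<le> card {j \<in> I. adj i j}"
    and column_degree: "\<And>j. j \<in> I \<Longrightarrow> real m / 10 \<le> card {i \<in> I. adj i j}"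
    and missing: "card {(i, j). i \<in> I \<and> j \<in> I \<and> \<not> adj i j} \<le> \<beta> * real m ^ 2"
    and R: "\<And>i j. i \<in> I \<Longrightarrow> j \<in> I \<Longrightarrow> card {k \<in> I. R i j k} \<le> \<mu> * m"
    and S: "\<And>j i. j \<in> I \<Longrightarrow> i \<in> I \<Longrightarrow> card {k \<in> I. S j i k} \<le> \<mu> * m"
    and R_sym: "\<And>i j k. R i j k \<Longrightarrow> R i k j"
    and S_sym: "\<And>i j k. S i j k \<Longrightarrow> S i k j"
begin

definition low :: "'i set" where
  "low = {i \<in> I. real m / 10 < card {j \<in> I. \<not> adj i j}} \<union> {j \<in> I. real m / 10 < card {i \<in> I. \<not> adj i j}}"

lemma \<gamma>_nonneg: "0 \<le> \<gamma>"
proof -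
  have "0 \<le> \<gamma> * m" using J(2) by (meson of_nat_0_le_iff order_trans)
  then show ?thesis using m by (simp add: zero_le_mult_iff)
qed

lemma \<mu>_less: "\<mu> < 1 / 4000000"
proof -
  have "sqrt \<mu> < 1 / 2000" using small pos \<gamma>_nonneg by linarith
  then have "(sqrt \<mu>)\<^sup>2 < (1 / 2000)\<^sup>2" using pos by (intro power_strict_mono) auto
  then show ?thesis using pos by (simp add: power2_eq_square)
qed

lemma \<beta>_\<gamma>_less: "\<gamma> + \<beta> < 1 / 2000"
  using small real_sqrt_ge_zero[of \<mu>] pos by linarith

lemma low_subset: "low \<subseteq> I" by (auto simp: low_def)

lemma card_low_le: "card low \<le> 20 * \<beta> * m"
proof -
  have m0: "real m > 0" using m by simp
  have "card {i \<in> I. real m / 10 < card {j \<in> I. \<not> adj i j}} * (real m / 10) \<le> \<beta> * real m ^ 2"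
    using card_rows_mult_le[OF fin fin, of "real m / 10" "\<lambda>i j. \<not> adj i j"] missing by linarith
  then have "card {i \<in> I. real m / 10 < card {j \<in> I. \<not> adj i j}} \<le> 10 * \<beta> * m"
    using m0 by (simp add: power2_eq_square field_simps)
  moreover have "card {j \<in> I. real m / 10 < card {i \<in> I. \<not> adj i j}} * (real m / 10) \<le> \<beta> * real m ^ 2"
    using card_rows_mult_le[OF fin fin, of "real m / 10" "\<lambda>j i. \<not> adj i j"] missing
      card_pairs_swap[of I I "\<lambda>i j. \<not> adj i j"] by linarith
  then have "card {j \<in> I. real m / 10 < card {i \<in> I. \<not> adj i j}} \<le> 10 * \<beta> * m"
    using m0 by (simp add: power2_eq_square field_simps)
  ultimately show ?thesis
    using card_Un_le[of "{i \<in> I. real m / 10 < card {j \<in> I. \<not> adj i j}}"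
        "{j \<in> I. real m / 10 < card {i \<in> I. \<not> adj i j}}"]
    unfolding low_def by linarith
qed

lemma high_degree:
  assumes "i \<in> I - low"
  shows "card {j \<in> I. \<not> adj i j} \<le> real m / 10" "card {j \<in> I. \<not> adj j i} \<le> real m / 10"
  using assms by (auto simp: low_def)

lemma ex_spread:
  "\<exists>\<pi>. bij_betw \<pi> I I \<and> (\<forall>i\<in>J \<union> low. \<pi> i = i) \<and> (\<forall>i\<in>I. adj i (\<pi> i)) \<and>
    (\<forall>k\<in>I. card {i \<in> I. R i k (\<pi> i)} \<le> real m / 50 \<and> card {i \<in> I. S (\<pi> i) k i} \<le> real m / 50)"
proof (cases "\<mu> * m < 1")
  case True
  have "\<not> R i j k" if "i \<in> I" "j \<in> I" "k \<in> I" for i j k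
  proof -
    have "card {k \<in> I. R i j k} = 0" using R[OF that(1,2)] True by linarith
    then show ?thesis using fin that by auto
  qed
  moreover have "\<not> S i j k" if "i \<in> I" "j \<in> I" "k \<in> I" for i j k
  proof -
    have "card {k \<in> I. S i j k} = 0" using S[OF that(1,2)] True by linarith
    then show ?thesis using fin that by auto
  qed
  ultimately have "card {i \<in> I. R i k i} = 0" "card {i \<in> I. S i k i} = 0" if "k \<in> I" for k
    using that by (auto simp: card_eq_0_iff)
  then show ?thesis using diag by (intro exI[of _ id]) auto
next
  case False
  define K where "K = J \<union> low"
  define Q where "Q = (\<lambda>(b, k) i j. if b then R i k j else S j k i)"
  define X where "X = (UNIV :: bool set) \<times> I"
  define N where "N = card K + nat \<lceil>6 * \<mu> * m\<rceil>"
  define r where "r = nat \<lceil>real m / 400\<rceil>"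
  have m0: "real m > 0" using m by simp
  have \<mu>m: "\<mu> * m \<le> real m / 4000000" using mult_right_mono[OF less_imp_le[OF \<mu>_less], of m] by simp
  then have mlarge: "4000000 \<le> real m" using False by linarith
  have KI: "K \<subseteq> I" using J low_subset by (auto simp: K_def)
  have "card K \<le> card J + card low" unfolding K_def by (rule card_Un_le)
  then have "card K \<le> \<gamma> * m + 20 * \<beta> * m" using J(2) card_low_le by linarith
  also have "\<dots> \<le> 20 * (\<gamma> + \<beta>) * m" using \<gamma>_nonneg by (simp add: algebra_simps)
  also have "\<dots> \<le> 20 * (1 / 2000) * m"
    using \<beta>_\<gamma>_less by (intro mult_right_mono) auto
  finally have cK: "card K \<le> real m / 100" by simp
  have "\<exists>\<pi>. bij_betw \<pi> I I \<and> (\<forall>i\<in>K. \<pi> i = i) \<and> (\<forall>i\<in>I. adj i (\<pi> i)) \<and>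
    (\<forall>x\<in>X. card {i \<in> I. Q x i (\<pi> i)} < N + r)"
  proof (rule ex_spread_matching[where \<nu> = "\<mu> * real m ^ 2" and d = "7/10 * real m"])
    show "real (card {(i, j). i \<in> I \<and> j \<in> I \<and> Q x i j}) \<le> \<mu> * real m ^ 2" if xX: "x \<in> X" for x
    proof -
      obtain b k where x: "x = (b, k)" "k \<in> I" using xX unfolding X_def by blast
      show ?thesis
      proof (cases b)
        case True
        then show ?thesis
          using card_pairs_le[OF fin fin, of "\<lambda>i j. R i k j" "\<mu> * m"] R x cardI
          by (simp add: Q_def power2_eq_square mult_ac)
      next
        case False
        then show ?thesis
          using card_pairs_le[OF fin fin, of "\<lambda>j i. S j k i" "\<mu> * m"] S x cardI
            card_pairs_swap[of I I "\<lambda>i j. S j k i"]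
          by (simp add: Q_def power2_eq_square mult_ac)
      qed
    qed
    show "real (card {k \<in> I - K. \<not> adj i k}) + real (card {k \<in> I - K. \<not> adj k j}) + 7/10 * real m
        \<le> card (I - K)" if "i \<in> I - K" "j \<in> I - K" for i j
    proof -
      have "card {k \<in> I - K. \<not> adj i k} \<le> card {k \<in> I. \<not> adj i k}"
        "card {k \<in> I - K. \<not> adj k j} \<le> card {k \<in> I. \<not> adj k j}"
        using fin by (auto intro: card_mono)
      moreover have "i \<in> I - low" "j \<in> I - low" using that by (auto simp: K_def)
      moreover have "card (I - K) = m - card K" "card K \<le> m"
        using fin KI cardI by (auto simp: card_Diff_subset finite_subset card_mono)
      ultimately show ?thesis using high_degree(1)[of i] high_degree(2)[of j] cK by simp
    qed
    have "6 * \<mu> * m \<le> real (nat \<lceil>6 * \<mu> * m\<rceil>)" by linarith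
    then have le: "7/10 * real m * (6 * \<mu> * m) \<le> 7/10 * real m * (real N - card K)"
      unfolding N_def by (intro mult_left_mono) auto
    have eq: "7/10 * real m * (6 * \<mu> * m) = 42/10 * (\<mu> * real m ^ 2)"
      by (simp add: power2_eq_square)
    show "4 * (\<mu> * real m ^ 2) \<le> 7/10 * real m * (real N - card K)"
      using le mult_nonneg_nonneg[of \<mu> "real m ^ 2", OF _ zero_le_power2] pos(1) unfolding eq
      by linarith
    have "4 * card X * (\<mu> * real m ^ 2) = 8 * (\<mu> * m) * (real m)\<^sup>2"
      unfolding X_def by (simp add: card_cartesian_product cardI power2_eq_square)
    also have "\<dots> \<le> 8 * (real m / 4000000) * (real m)\<^sup>2"
      using \<mu>m by (intro mult_right_mono mult_left_mono) auto
    also have "\<dots> < 7/10 * real m * ((real m / 400) * (real m / 400))"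
      using m0 by (simp add: power2_eq_square)
    also have "\<dots> \<le> 7/10 * real m * (real r * 2 ^ r)"
    proof (intro mult_left_mono mult_mono)
      show "real m / 400 \<le> real r" unfolding r_def by linarith
      also have "\<dots> \<le> 2 ^ r" using less_exp[of r] by (metis less_imp_le of_nat_le_iff of_nat_numeral of_nat_power)
      finally show "real m / 400 \<le> 2 ^ r" .
    qed auto
    finally show "4 * card X * (\<mu> * real m ^ 2) < 7/10 * real m * r * 2 ^ r" by simp
  qed (use fin KI diag m0 in \<open>auto simp: X_def\<close>)
  then obtain \<pi> where \<pi>: "bij_betw \<pi> I I" "\<forall>i\<in>K. \<pi> i = i" "\<forall>i\<in>I. adj i (\<pi> i)"
    "\<And>x. x \<in> X \<Longrightarrow> card {i \<in> I. Q x i (\<pi> i)} < N + r" by auto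
  have "real (N + r) \<le> card K + (6 * \<mu> * m + 1) + (real m / 400 + 1)"
    using pos m0 unfolding N_def r_def by (simp add: of_nat_nat) linarith
  also have "\<dots> \<le> real m / 50" using cK \<mu>m mlarge by linarith
  finally have Nr: "real (N + r) \<le> real m / 50" .
  have "card {i \<in> I. R i k (\<pi> i)} \<le> real m / 50 \<and> card {i \<in> I. S (\<pi> i) k i} \<le> real m / 50"
    if "k \<in> I" for k
    using \<pi>(4)[of "(True, k)"] \<pi>(4)[of "(False, k)"] that Nr by (auto simp: X_def Q_def)
  then show ?thesis using \<pi> unfolding K_def by blast
qed

lemma ex_cyclic_arrangement:
  "\<exists>\<pi> xs. bij_betw \<pi> I I \<and> (\<forall>i\<in>J. \<pi> i = i) \<and> (\<forall>i\<in>I. adj i (\<pi> i)) \<and> distinct xs \<and> set xs = I \<and>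
    (let D = (\<lambda>i j. adj j (\<pi> i) \<and> \<not> R j (\<pi> i) (\<pi> j) \<and> \<not> S (\<pi> i) j i)
     in successively D xs \<and> D (last xs) (hd xs))"
proof -
  obtain \<pi> where \<pi>: "bij_betw \<pi> I I" "\<forall>i\<in>J \<union> low. \<pi> i = i" "\<forall>i\<in>I. adj i (\<pi> i)"
    and Rk: "\<And>k. k \<in> I \<Longrightarrow> card {i \<in> I. R i k (\<pi> i)} \<le> real m / 50"
    and Sk: "\<And>k. k \<in> I \<Longrightarrow> card {i \<in> I. S (\<pi> i) k i} \<le> real m / 50"
    using ex_spread by blast
  define D where "D i j \<longleftrightarrow> adj j (\<pi> i) \<and> \<not> R j (\<pi> i) (\<pi> j) \<and> \<not> S (\<pi> i) j i" for i j
  have \<pi>I: "\<pi> i \<in> I" if "i \<in> I" for i using \<pi>(1) that bij_betwE by blast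
  have \<pi>low: "\<pi> i \<in> I - low" if "i \<in> I - low" for i
    using that \<pi>I[of i] \<pi>(2) inj_onD[OF bij_betw_imp_inj_on[OF \<pi>(1)], of "\<pi> i" i] by auto
  have m0: "real m > 0" using m by simp
  have \<mu>m: "\<mu> * m \<le> real m / 4000000" using mult_right_mono[OF less_imp_le[OF \<mu>_less], of m] by simp
  have card3: "real (card (P \<union> Q \<union> T)) \<le> real (card P) + real (card Q) + real (card T)" for P Q T :: "'i set"
    using card_Un_le[of "P \<union> Q" T] card_Un_le[of P Q] by linarith
  have out_bad: "card ({j \<in> I. R j (\<pi> i) (\<pi> j)} \<union> {j \<in> I. S (\<pi> i) j i} \<union> Z) \<le> real m / 40 + card Z"
    if "i \<in> I" for i Z
  proof -
    have "{j \<in> I. S (\<pi> i) j i} = {j \<in> I. S (\<pi> i) i j}" using S_sym by blast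
    then have "card {j \<in> I. S (\<pi> i) j i} = card {j \<in> I. S (\<pi> i) i j}" by simp
    then show ?thesis
      using card3[of "{j \<in> I. R j (\<pi> i) (\<pi> j)}" "{j \<in> I. S (\<pi> i) j i}" Z]
        Rk[OF \<pi>I[OF that]] S[OF \<pi>I[OF that] that] \<mu>m m0 by linarith
  qed
  have in_bad: "card ({j \<in> I. R i (\<pi> j) (\<pi> i)} \<union> {j \<in> I. S (\<pi> j) i j} \<union> Z) \<le> real m / 40 + card Z"
    if "i \<in> I" for i Z
  proof -
    have "{j \<in> I. R i j (\<pi> i)} = {j \<in> I. R i (\<pi> i) j}" using R_sym by blast
    then have "card {j \<in> I. R i (\<pi> j) (\<pi> i)} \<le> \<mu> * m"
      using card_Collect_bij_betw[OF \<pi>(1), of "\<lambda>j. R i j (\<pi> i)"] R[OF that \<pi>I[OF that]] by simp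
    then show ?thesis
      using card3[of "{j \<in> I. R i (\<pi> j) (\<pi> i)}" "{j \<in> I. S (\<pi> j) i j}" Z]
        Sk[OF that] \<mu>m m0 by linarith
  qed
  have col: "card {j \<in> I. P (\<pi> j)} = card {j \<in> I. P j}" for P
    by (rule card_Collect_bij_betw[OF \<pi>(1)])
  have low5: "5 * real (card low) \<le> real m / 20"
  proof -
    have "20 * \<beta> * m \<le> 20 * (1 / 2000) * m"
      using \<beta>_\<gamma>_less \<gamma>_nonneg by (intro mult_right_mono) auto
    then show ?thesis using card_low_le by simp
  qed
  have "\<exists>xs. distinct xs \<and> set xs = I \<and> successively D xs \<and> D (last xs) (hd xs)"
  proof (rule directed_hamilton_cycle[OF fin _ low_subset])
    show "2 \<le> card I" using m cardI by simp
    show "10 * card low \<le> card I" using low5 cardI by linarith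
    show "8 * card {w \<in> I. w \<noteq> v \<and> \<not> D v w} \<le> card I" if v: "v \<in> I - low" for v
    proof -
      let ?Z = "{j \<in> I. \<not> adj j (\<pi> v)}"
      have "card {w \<in> I. w \<noteq> v \<and> \<not> D v w} \<le>
          card ({j \<in> I. R j (\<pi> v) (\<pi> j)} \<union> {j \<in> I. S (\<pi> v) j v} \<union> ?Z)"
        using fin by (intro card_mono) (auto simp: D_def)
      then have "real (card {w \<in> I. w \<noteq> v \<and> \<not> D v w}) \<le> real m / 40 + card ?Z"
        using out_bad[of v ?Z] v by simp
      then show ?thesis using high_degree(2)[OF \<pi>low[OF v]] cardI by linarith
    qed
    show "8 * card {w \<in> I. w \<noteq> v \<and> \<not> D w v} \<le> card I" if v: "v \<in> I - low" for v
    proof -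
      let ?Z = "{j \<in> I. \<not> adj v (\<pi> j)}"
      have "card {w \<in> I. w \<noteq> v \<and> \<not> D w v} \<le>
          card ({j \<in> I. R v (\<pi> j) (\<pi> v)} \<union> {j \<in> I. S (\<pi> j) v j} \<union> ?Z)"
        using fin by (intro card_mono) (auto simp: D_def)
      then have "real (card {w \<in> I. w \<noteq> v \<and> \<not> D w v}) \<le> real m / 40 + card ?Z"
        using in_bad[of v ?Z] v by simp
      then show ?thesis
        using high_degree(1)[OF v] col[of "\<lambda>j. \<not> adj v j"] cardI by linarith
    qed
    show "5 * card low \<le> card {w \<in> I. D v w}" if v: "v \<in> low" for v
    proof -
      have vI: "v \<in> I" using v low_subset by auto
      have "card {j \<in> I. adj j (\<pi> v)} \<le>
          card ({j \<in> I. R j (\<pi> v) (\<pi> j)} \<union> {j \<in> I. S (\<pi> v) j v} \<union> {w \<in> I. D v w})"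
        using fin by (intro card_mono) (auto simp: D_def)
      then have "real m / 10 \<le> real m / 40 + card {w \<in> I. D v w}"
        using out_bad[OF vI, of "{w \<in> I. D v w}"] column_degree[OF \<pi>I[OF vI]] by linarith
      then show ?thesis using low5 m0 by linarith
    qed
    show "5 * card low \<le> card {w \<in> I. D w v}" if v: "v \<in> low" for v
    proof -
      have vI: "v \<in> I" using v low_subset by auto
      have "card {j \<in> I. adj v (\<pi> j)} \<le>
          card ({j \<in> I. R v (\<pi> j) (\<pi> v)} \<union> {j \<in> I. S (\<pi> j) v j} \<union> {w \<in> I. D w v})"
        using fin by (intro card_mono) (auto simp: D_def)
      then have "real m / 10 \<le> real m / 40 + card {w \<in> I. D w v}"
        using in_bad[OF vI, of "{w \<in> I. D w v}"] row_degree[OF vI] col[of "adj v"] by linarith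
      then show ?thesis using low5 m0 by linarith
    qed
  qed
  then show ?thesis using \<pi> unfolding D_def Let_def by blast
qed

end

theorem theorem3p5:
  fixes \<mu> \<beta> \<gamma> :: real and m :: nat
    and A B :: "'a set" and E :: "'a set set"
    and F :: "'a \<Rightarrow> 'a set set set" and em :: "nat \<Rightarrow> 'a set"
  assumes "\<mu> > 0" "\<beta> > 0" "\<gamma> > 0"
    and "\<gamma> + \<beta> + sqrt \<mu> < 1 / 2000"
    and "m \<ge> 2"
    and "bipartite_graph A B E"
    and "card A = m" "card B = m"
    and "\<forall>v\<in>A \<union> B. real (degree E v) \<ge> real m / 10"
    and "real (e_between E A B) \<ge> (1 - \<beta>) * real m ^ 2"
    and "incompatibility_system E F"
    and "bounded_incompat (\<mu> * real m) E F"
    and "\<forall>i\<in>{1..m}. em i \<in> E"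
    and "\<forall>i\<in>{1..m}. \<forall>j\<in>{1..m}. i \<noteq> j \<longrightarrow> em i \<inter> em j = {}"
    and "(\<Union>i\<in>{1..m}. em i) = A \<union> B"
  shows "\<exists>vs. hamilton_cycle (A \<union> B) E vs \<and> compatible_cycle F vs \<and>
           (\<forall>i\<in>{1..nat \<lfloor>\<gamma> * real m\<rfloor>}. em i \<in> cycle_edges vs)"
proof -
  define I where "I = {1..m}"
  have finI: "finite I" and cI: "card I = m" by (auto simp: I_def)
  have finAB: "finite A" "finite B" and AB: "A \<inter> B = {}"
    and EAB: "\<And>e. e \<in> E \<Longrightarrow> \<exists>a\<in>A. \<exists>b\<in>B. e = {a, b}"
    using assms(6) by (auto simp: bipartite_graph_def)
  have finE: "finite E"
  proof (rule finite_subset)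
    show "E \<subseteq> Pow (A \<union> B)" using EAB by blast
  qed (use finAB in simp)
  have "\<forall>i\<in>I. \<exists>p. fst p \<in> A \<and> snd p \<in> B \<and> em i = {fst p, snd p}"
    using EAB assms(13) unfolding I_def by fastforce
  then obtain p where p: "\<And>i. i \<in> I \<Longrightarrow> fst (p i) \<in> A \<and> snd (p i) \<in> B \<and> em i = {fst (p i), snd (p i)}"
    by metis
  define a b where "a i = fst (p i)" and "b i = snd (p i)" for i
  have ab: "a i \<in> A" "b i \<in> B" "em i = {a i, b i}" if "i \<in> I" for i
    using p[OF that] by (auto simp: a_def b_def)
  have disj: "em i \<inter> em j = {}" if "i \<in> I" "j \<in> I" "i \<noteq> j" for i j
    using assms(14) that by (auto simp: I_def)
  have inja: "inj_on a I" and injb: "inj_on b I"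
    using disj ab by (auto simp: inj_on_def)
  have ima: "a ` I = A" and imb: "b ` I = B"
    using finAB ab assms(7,8) cI card_image[OF inja] card_image[OF injb]
    by (simp_all add: card_subset_eq image_subset_iff)
  have bija: "bij_betw a I A" and bijb: "bij_betw b I B"
    using inja injb ima imb by (auto simp: bij_betw_def)
  define adj where "adj i j \<longleftrightarrow> {a i, b j} \<in> E" for i j
  define R where "R i j k \<longleftrightarrow> incompatible F {a i, b j} {a i, b k}" for i j k
  define S where "S j i k \<longleftrightarrow> incompatible F {b j, a i} {b j, a k}" for j i k
  define J where "J = {1..nat \<lfloor>\<gamma> * real m\<rfloor>}"
  have \<gamma>1: "\<gamma> \<le> 1" using assms(1,2,4) real_sqrt_ge_zero[of \<mu>] by linarith
  have "dense_index_system I m adj R S J \<mu> \<beta> \<gamma>"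
  proof
    show "J \<subseteq> I"
    proof -
      have "\<gamma> * real m \<le> 1 * real m" using \<gamma>1 by (intro mult_right_mono) auto
      then have "nat \<lfloor>\<gamma> * real m\<rfloor> \<le> m" by linarith
      then show ?thesis by (auto simp: J_def I_def)
    qed
    show "real (card J) \<le> \<gamma> * real m" unfolding J_def using assms(3) by simp
    show "adj i i" if "i \<in> I" for i using assms(13) that ab(3)[OF that] unfolding adj_def I_def by metis
    show "real m / 10 \<le> real (card {j \<in> I. adj i j})" if "i \<in> I" for i
    proof -
      have "{e \<in> E. a i \<in> e} \<subseteq> (\<lambda>j. {a i, b j}) ` {j \<in> I. adj i j}"
      proof
        fix e assume "e \<in> {e \<in> E. a i \<in> e}"
        then have e: "e \<in> E" "a i \<in> e" by auto
        then obtain x y where "x \<in> A" "y \<in> B" "e = {x, y}" using EAB by blast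
        then have xy: "x = a i" "y \<in> B" "e = {x, y}" using AB e ab(1)[OF that] by auto
        then obtain j where "j \<in> I" "y = b j" using imb by auto
        then show "e \<in> (\<lambda>j. {a i, b j}) ` {j \<in> I. adj i j}" using xy e by (auto simp: adj_def)
      qed
      then have "degree E (a i) \<le> card {j \<in> I. adj i j}"
        unfolding degree_def using finI by (intro surj_card_le) auto
      moreover have "real m / 10 \<le> degree E (a i)" using assms(9) ab[OF that] by auto
      ultimately show ?thesis by linarith
    qed
    show "real m / 10 \<le> real (card {i \<in> I. adj i j})" if "j \<in> I" for j
    proof -
      have "{e \<in> E. b j \<in> e} \<subseteq> (\<lambda>i. {a i, b j}) ` {i \<in> I. adj i j}"
      proof
        fix e assume "e \<in> {e \<in> E. b j \<in> e}"
        then have e: "e \<in> E" "b j \<in> e" by auto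
        then obtain x y where "x \<in> A" "y \<in> B" "e = {x, y}" using EAB by blast
        then have xy: "y = b j" "x \<in> A" "e = {x, y}" using AB e ab(2)[OF that] by auto
        then obtain i where "i \<in> I" "x = a i" using ima by auto
        then show "e \<in> (\<lambda>i. {a i, b j}) ` {i \<in> I. adj i j}" using xy e by (auto simp: adj_def)
      qed
      then have "degree E (b j) \<le> card {i \<in> I. adj i j}"
        unfolding degree_def using finI by (intro surj_card_le) auto
      moreover have "real m / 10 \<le> degree E (b j)" using assms(9) ab[OF that] by auto
      ultimately show ?thesis by linarith
    qed
    show "real (card {(i, j). i \<in> I \<and> j \<in> I \<and> \<not> adj i j}) \<le> \<beta> * real m ^ 2"
    proof -
      let ?Y = "{(i, j). i \<in> I \<and> j \<in> I \<and> adj i j}" and ?N = "{(i, j). i \<in> I \<and> j \<in> I \<and> \<not> adj i j}"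
      have finYN: "finite ?Y" "finite ?N"
        using finI by (auto intro: finite_subset[of _ "I \<times> I"])
      have "{e \<in> E. \<exists>x\<in>A. \<exists>y\<in>B. e = {x, y}} \<subseteq> (\<lambda>(i, j). {a i, b j}) ` ?Y"
        unfolding ima[symmetric] imb[symmetric] adj_def by auto
      then have "e_between E A B \<le> card ?Y"
        unfolding e_between_def using finYN by (intro surj_card_le)
      moreover have "card ?Y + card ?N = card (I \<times> I)"
        using finYN by (subst card_Un_disjoint[symmetric]) (auto intro: arg_cong[of _ _ card])
      then have "real (card ?Y) + real (card ?N) = real m ^ 2"
        by (simp add: card_cartesian_product cI power2_eq_square flip: of_nat_add)
      ultimately show ?thesis using assms(10) by (simp add: algebra_simps)
    qed
    show "real (card {k \<in> I. R i j k}) \<le> \<mu> * real m" if "i \<in> I" "j \<in> I" for i j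
      unfolding R_def using assms(1) AB ab(1)[OF that(1)] imb
      by (intro card_incompatible_le[OF assms(11,12) _ finE injb]) auto
    show "real (card {k \<in> I. S j i k}) \<le> \<mu> * real m" if "j \<in> I" "i \<in> I" for i j
      unfolding S_def using assms(1) AB ab(2)[OF that(1)] ima
      by (intro card_incompatible_le[OF assms(11,12) _ finE inja]) auto
    show "R i k j" if "R i j k" for i j k
      using that unfolding R_def by (subst incompatible_commute)
    show "S i k j" if "S i j k" for i j k
      using that unfolding S_def by (subst incompatible_commute)
  qed (use assms finI cI in auto)
  then interpret dense_index_system I m adj R S J \<mu> \<beta> \<gamma> .
  define D where "D \<pi> i j \<longleftrightarrow> adj j (\<pi> i) \<and> \<not> R j (\<pi> i) (\<pi> j) \<and> \<not> S (\<pi> i) j i" for \<pi> :: "nat \<Rightarrow> nat" and i j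
  obtain \<pi> xs where \<pi>: "bij_betw \<pi> I I" "\<forall>i\<in>J. \<pi> i = i" "\<forall>i\<in>I. adj i (\<pi> i)"
    and xs: "distinct xs" "set xs = I" "successively (D \<pi>) xs" "D \<pi> (last xs) (hd xs)"
    using ex_cyclic_arrangement unfolding D_def Let_def by blast
  have "\<exists>vs. hamilton_cycle (A \<union> B) E vs \<and> compatible_cycle F vs \<and>
      (\<forall>i\<in>I. {a i, (b \<circ> \<pi>) i} \<in> cycle_edges vs)"
  proof (rule compatible_hamilton_cycleI[OF bija _ AB assms(11) xs(1,2) _ xs(3,4)])
    show "bij_betw (b \<circ> \<pi>) I B" using \<pi>(1) bijb by (rule bij_betw_trans)
    show "2 \<le> length xs" using distinct_card[OF xs(1)] xs(2) cI assms(5) by simp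
    show "{a i, (b \<circ> \<pi>) i} \<in> E" if "i \<in> I" for i using \<pi>(3) that by (simp add: adj_def)
    show "{(b \<circ> \<pi>) i, a j} \<in> E \<and> \<not> incompatible F {(b \<circ> \<pi>) i, a j} {a i, (b \<circ> \<pi>) i} \<and>
        \<not> incompatible F {(b \<circ> \<pi>) i, a j} {a j, (b \<circ> \<pi>) j}" if "D \<pi> i j" for i j
      using that by (simp add: D_def adj_def R_def S_def insert_commute)
  qed
  then obtain vs where vs: "hamilton_cycle (A \<union> B) E vs" "compatible_cycle F vs"
      "\<forall>i\<in>I. {a i, b (\<pi> i)} \<in> cycle_edges vs" by auto
  have "em i \<in> cycle_edges vs" if "i \<in> J" for i
  proof -
    have "i \<in> I" using that J by auto
    then show ?thesis using vs(3) \<pi>(2) ab(3) that by metis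
  qed
  then show ?thesis using vs unfolding J_def by blast
qed

end
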